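(* For every undirected unweighted graph $G$, the randomized greedy matching algorithm (sample a uniformly random ordering of the edges; starting from $M=\emptyset$, consider edges in this order and add an edge $(u,v)$ to $M$ iff both $u$ and $v$ are unmatched in $M$; output $M$) has average sensitivity $\beta(G)\le\frac12+\Delta$, where $\Delta$ is the maximum degree of $G$.
   Context: For a randomized algorithm $\mathcal{A}$ with output distribution $\mathcal{A}(G)$ (a distribution over edge sets), its average sensitivity at $G=(V,E)$ is $\beta(G)=\mathbb{E}_{e\sim E}[d_{\mathrm{EM}}(\mathcal{A}(G),\mathcal{A}(G-e))]$, where $e$ is uniform in $E$, $G-e$ is $G$ with $e$ deleted, and $d_{\mathrm{EM}}$ is the earth mover's distance with respect to Hamming distance (size of symmetric difference). *)

theory Defs
  imports "HOL-Probability.Probability" "HOL-Combinatorics.Multiset_Permutations"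
begin

text \<open>An edge joining \<open>u\<close> and \<open>v\<close> is the two-element set \<open>{u, v}\<close>.\<close>

definition finite_simple_graph :: "'a set \<Rightarrow> 'a set set \<Rightarrow> bool" where
  "finite_simple_graph V E \<longleftrightarrow> finite V \<and> (\<forall>e\<in>E. e \<subseteq> V \<and> card e = 2)"

definition vertex_degree :: "'a set set \<Rightarrow> 'a \<Rightarrow> nat" where
  "vertex_degree E v = card {e \<in> E. v \<in> e}"

text \<open>The inserted \<open>0\<close> only matters for the graph without vertices.\<close>

definition max_degree :: "'a set \<Rightarrow> 'a set set \<Rightarrow> nat" where
  "max_degree V E = Max (insert 0 (vertex_degree E ` V))"

definition hamming :: "'b set \<Rightarrow> 'b set \<Rightarrow> real" where
  "hamming A B = real (card ((A - B) \<union> (B - A)))"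

definition couplings :: "'b pmf \<Rightarrow> 'c pmf \<Rightarrow> ('b \<times> 'c) pmf set" where
  "couplings p q = {r. map_pmf fst r = p \<and> map_pmf snd r = q}"

text \<open>
  Intended for finitely supported distributions over finite sets, where every integral below
  exists.
\<close>

definition em_dist :: "'b set pmf \<Rightarrow> 'b set pmf \<Rightarrow> real" where
  "em_dist p q =
     (INF r \<in> couplings p q. measure_pmf.expectation r (\<lambda>(A, B). hamming A B))"

text \<open>
  A randomized algorithm maps a graph to a distribution over edge sets. For an edgeless graph,
  where a uniformly random edge does not exist, the average is \<open>0\<close> by \<open>0 / 0 = 0\<close>.
\<close>

definition average_sensitivity ::
  "('a set \<Rightarrow> 'a set set \<Rightarrow> 'a set set pmf) \<Rightarrow> 'a set \<Rightarrow> 'a set set \<Rightarrow> real" where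
  "average_sensitivity Alg V E =
     (\<Sum>e\<in>E. em_dist (Alg V E) (Alg V (E - {e}))) / real (card E)"

definition greedy_step :: "'a set set \<Rightarrow> 'a set \<Rightarrow> 'a set set" where
  "greedy_step M e = (if \<forall>v\<in>e. v \<notin> \<Union>M then insert e M else M)"

definition greedy_matching :: "'a set list \<Rightarrow> 'a set set" where
  "greedy_matching es = foldl greedy_step {} es"

definition randomized_greedy_matching :: "'a set \<Rightarrow> 'a set set \<Rightarrow> 'a set set pmf" where
  "randomized_greedy_matching V E =
     map_pmf greedy_matching (pmf_of_set (permutations_of_set E))"

end

theory Submission
  imports Defs
begin

text \<open>
  Run greedy on the same uniformly random order of \<open>E\<close> with and without \<open>e\<close>. The expected
  Hamming distance of the outputs is at most \<open>1\<close>, by induction on \<open>n = |E|\<close>, conditioning on the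
  first edge \<open>f\<close>. Let \<open>d\<close> edges meet \<open>e\<close>. If \<open>f = e\<close>, the two runs differ by \<open>e\<close> and by the
  deletion of these \<open>d\<close> edges from \<open>E - e\<close>; deleting them one at a time costs at most \<open>1\<close> each by
  induction. If \<open>f\<close> is one of these \<open>d\<close> edges, \<open>e\<close> is rejected and the runs agree. Otherwise both
  runs restrict to the edges that miss \<open>f\<close>, and induction applies. The average is at most
  \<open>((1 + d) + 0 + (n - 1 - d)) / n = 1\<close>. Finally \<open>1 \<le> 1/2 + \<Delta>\<close>, since a graph with an edge has
  \<open>\<Delta> \<ge> 1\<close>.
\<close>

abbreviation random_order_expectation :: "'b set \<Rightarrow> ('b list \<Rightarrow> real) \<Rightarrow> real" where
  "random_order_expectation A F \<equiv>
     measure_pmf.expectation (pmf_of_set (permutations_of_set A)) F"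

lemma integrable_random_order:
  fixes F :: "'b list \<Rightarrow> real"
  assumes "finite A"
  shows "integrable (measure_pmf (pmf_of_set (permutations_of_set A))) F"
  using assms by (intro integrable_measure_pmf_finite) simp

lemma random_order_expectation_mono:
  assumes "finite A" "\<And>xs. xs \<in> permutations_of_set A \<Longrightarrow> F xs \<le> G xs"
  shows "random_order_expectation A F \<le> random_order_expectation A G"
  using assms by (intro integral_mono_AE integrable_random_order) (auto simp: AE_measure_pmf_iff)

text \<open>A uniform order is a uniform first entry followed by a uniform order of the rest. This
  is the conditioning step of the main induction.\<close>

lemma random_order_expectation_first:
  assumes "finite A" "A \<noteq> {}"
  shows "random_order_expectation A F =
           (\<Sum>a\<in>A. random_order_expectation (A - {a}) (\<lambda>xs. F (a # xs))) / real (card A)"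
proof -
  have "random_order_expectation A F = measure_pmf.expectation (pmf_of_set A \<bind>
          (\<lambda>a. map_pmf ((#) a) (pmf_of_set (permutations_of_set (A - {a}))))) F"
    using assms by (simp add: random_permutation_of_set map_pmf_def)
  also have "\<dots> = (\<Sum>a\<in>A. random_order_expectation (A - {a}) (\<lambda>xs. F (a # xs))) / real (card A)"
    using assms
    by (subst pmf_expectation_bind_pmf_of_set)
       (auto simp: divide_inverse mult.commute simp flip: sum_distrib_left)
  finally show ?thesis .
qed

text \<open>Partitioning a uniform order by \<open>P\<close> yields a pair of independent uniform
  orders of the two classes; the first marginal is the claim. It keeps the induction among uniform
  orders whenever edges are discarded.\<close>

lemma random_order_filter:
  assumes "finite A"
  shows "map_pmf (filter P) (pmf_of_set (permutations_of_set A)) =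
           pmf_of_set (permutations_of_set {x \<in> A. P x})"
proof -
  have "map_pmf (filter P) (pmf_of_set (permutations_of_set A)) =
          map_pmf fst (map_pmf (partition P) (pmf_of_set (permutations_of_set A)))"
    by (simp add: pmf.map_comp o_def)
  then show ?thesis
    by (simp only: partition_random_permutations[OF assms] map_fst_pair_pmf)
qed

lemma random_order_expectation_filter:
  assumes "finite A"
  shows "random_order_expectation A (\<lambda>xs. F (filter P xs)) =
           random_order_expectation {x \<in> A. P x} F"
  by (simp flip: random_order_filter[OF assms])

lemma hamming_self [simp]: "hamming A A = 0"
  by (simp add: hamming_def)

lemma hamming_nonneg [simp]: "0 \<le> hamming A B"
  by (simp add: hamming_def)

lemma hamming_triangle:
  assumes "finite A" "finite B" "finite C"
  shows "hamming A C \<le> hamming A B + hamming B C"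
proof -
  have "card ((A - C) \<union> (C - A)) \<le> card (((A - B) \<union> (B - A)) \<union> ((B - C) \<union> (C - B)))"
    using assms by (intro card_mono) auto
  also have "\<dots> \<le> card ((A - B) \<union> (B - A)) + card ((B - C) \<union> (C - B))"
    by (rule card_Un_le)
  finally show ?thesis by (simp add: hamming_def)
qed

lemma hamming_insert_insert_le:
  assumes "finite A" "finite B"
  shows "hamming (insert x A) (insert x B) \<le> hamming A B"
  using assms unfolding hamming_def of_nat_le_iff by (intro card_mono) auto

text \<open>The arguments are swapped on the right so that the full run comes first, as in the bound
  for deleting a set of edges.\<close>

lemma hamming_insert_le:
  assumes "finite A" "finite B"
  shows "hamming (insert x A) B \<le> 1 + hamming B A"
proof -
  have "card ((insert x A - B) \<union> (B - insert x A)) \<le> card (insert x ((B - A) \<union> (A - B)))"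
    using assms by (intro card_mono) auto
  also have "\<dots> \<le> Suc (card ((B - A) \<union> (A - B)))"
    by (rule card_insert_le_m1) auto
  finally show ?thesis by (simp add: hamming_def)
qed

text \<open>Once \<open>f\<close> is chosen, an edge meeting \<open>f\<close> is always rejected, so
  it may be dropped in advance; for an edge missing \<open>f\<close>, the presence of
  \<open>f\<close> does not affect the acceptance test.\<close>

lemma foldl_greedy_step_insert:
  "foldl greedy_step (insert f M) es =
     insert f (foldl greedy_step M (filter (\<lambda>x. x \<inter> f = {}) es))"
proof (induction es arbitrary: M)
  case (Cons x es)
  show ?case
  proof (cases "x \<inter> f = {}")
    case True
    then have "greedy_step (insert f M) x = insert f (greedy_step M x)"
      by (auto simp: greedy_step_def)
    with True Cons.IH show ?thesis by simp
  next
    case False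
    then have "greedy_step (insert f M) x = insert f M"
      by (auto simp: greedy_step_def)
    with False Cons.IH show ?thesis by simp
  qed
qed simp

lemma greedy_matching_Cons:
  "greedy_matching (f # es) = insert f (greedy_matching (filter (\<lambda>x. x \<inter> f = {}) es))"
  using foldl_greedy_step_insert[of f "{}" es] by (simp add: greedy_matching_def greedy_step_def)

lemma finite_greedy_matching [simp]: "finite (greedy_matching es)"
proof -
  have "finite M \<Longrightarrow> finite (foldl greedy_step M es)" for M :: "'a set set"
    by (induction es arbitrary: M) (auto simp: greedy_step_def)
  then show ?thesis by (simp add: greedy_matching_def)
qed

text \<open>Triangle inequality along the chain of single deletions. The bound \<open>single\<close>
  is a hypothesis because the induction below supplies it only for smaller edge sets.\<close>

lemma expected_change_delete_set:
  assumes "finite H" "K \<subseteq> H"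
    and single: "\<And>A e. A \<subseteq> H \<Longrightarrow> e \<in> A \<Longrightarrow>
      random_order_expectation A
        (\<lambda>es. hamming (greedy_matching es) (greedy_matching (filter (\<lambda>x. x \<noteq> e) es))) \<le> 1"
  shows "random_order_expectation H
           (\<lambda>es. hamming (greedy_matching es) (greedy_matching (filter (\<lambda>x. x \<notin> K) es)))
         \<le> real (card K)"
proof -
  have "finite K" using assms finite_subset by blast
  then show ?thesis using \<open>K \<subseteq> H\<close>
  proof (induction K)
    case (insert k K)
    let ?del = "\<lambda>K. filter (\<lambda>x. x \<notin> K)"
    let ?g = greedy_matching
    have "random_order_expectation H (\<lambda>es. hamming (?g es) (?g (?del (insert k K) es))) \<le>
            random_order_expectation H (\<lambda>es. hamming (?g es) (?g (?del K es)) +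
              hamming (?g (?del K es)) (?g (?del (insert k K) es)))"
      using \<open>finite H\<close> by (intro random_order_expectation_mono hamming_triangle) auto
    also have "\<dots> = random_order_expectation H (\<lambda>es. hamming (?g es) (?g (?del K es))) +
        random_order_expectation H (\<lambda>es. hamming (?g (?del K es)) (?g (?del (insert k K) es)))"
      using \<open>finite H\<close> by (intro Bochner_Integration.integral_add integrable_random_order)
    also have "(\<lambda>es. hamming (?g (?del K es)) (?g (?del (insert k K) es))) =
        (\<lambda>es. hamming (?g (?del K es)) (?g (filter (\<lambda>x. x \<noteq> k) (?del K es))))"
      by (auto simp: conj_commute intro!: arg_cong2[where f = hamming] arg_cong[where f = ?g]
            filter_cong)
    \<comment> \<open>With \<open>K\<close> deleted, the order is still uniform on what remains, so
      \<open>single\<close> covers the deletion of \<open>k\<close>.\<close>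
    also have "random_order_expectation H \<dots> = random_order_expectation {x \<in> H. x \<notin> K}
        (\<lambda>es. hamming (?g es) (?g (filter (\<lambda>x. x \<noteq> k) es)))"
      using \<open>finite H\<close> by (rule random_order_expectation_filter)
    also have "\<dots> \<le> 1"
      using insert by (intro single) auto
    also have "random_order_expectation H (\<lambda>es. hamming (?g es) (?g (?del K es))) \<le> real (card K)"
      using insert by simp
    finally show ?case using insert by simp
  qed simp
qed

lemma expected_change_delete:
  assumes "finite H" "e \<in> H"
  shows "random_order_expectation H
           (\<lambda>es. hamming (greedy_matching es) (greedy_matching (filter (\<lambda>x. x \<noteq> e) es))) \<le> 1"
  using assms
proof (induction "card H" arbitrary: H e rule: less_induct)
  case less
  let ?g = greedy_matching
  let ?change = "\<lambda>e es. hamming (?g es) (?g (filter (\<lambda>x. x \<noteq> e) es))"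
  \<comment> \<open>These are the \<open>d\<close> edges meeting \<open>e\<close>, with
    \<open>e\<close> itself excluded.\<close>
  define N where "N = {x \<in> H - {e}. x \<inter> e \<noteq> {}}"
  note [simp] = \<open>finite H\<close>
  have "N \<subseteq> H" "e \<notin> N" "finite N" by (auto simp: N_def)
  \<comment> \<open>The induction hypothesis; the missing edge \<open>f\<close> witnesses that
    \<open>A\<close> is strictly smaller than \<open>H\<close>.\<close>
  have smaller: "random_order_expectation A (?change a) \<le> 1"
    if "A \<subseteq> H - {f}" "f \<in> H" "a \<in> A" for A a f
  proof (rule less.hyps)
    show "card A < card H" using that by (intro psubset_card_mono) auto
    show "finite A" using that by (auto intro: finite_subset)
  qed (use that in auto)
  have "random_order_expectation (H - {f}) (\<lambda>es. ?change e (f # es)) \<le>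
          (if f = e then 1 + real (card N) else if f \<in> N then 0 else 1)"
    if "f \<in> H" for f
  proof -
    consider (same) "f = e" | (adj) "f \<in> N" | (far) "f \<noteq> e" "f \<inter> e = {}"
      using \<open>f \<in> H\<close> by (auto simp: N_def)
    then show ?thesis
    proof cases
      case same
      have "random_order_expectation (H - {e}) (\<lambda>es. ?change e (e # es)) \<le>
          random_order_expectation (H - {e})
            (\<lambda>es. 1 + hamming (?g es) (?g (filter (\<lambda>x. x \<notin> N) es)))"
      proof (rule random_order_expectation_mono)
        fix es assume "es \<in> permutations_of_set (H - {e})"
        then have "set es = H - {e}" by (rule permutations_of_setD)
        \<comment> \<open>As \<open>e\<close> does not occur in \<open>es\<close>, the run without
          \<open>e\<close> sees all of \<open>es\<close>, while the run that starts with
          \<open>e\<close> sees \<open>es\<close> without \<open>N\<close>.\<close>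
        then have "filter (\<lambda>x. x \<noteq> e) es = es"
          and "filter (\<lambda>x. x \<inter> e = {}) es = filter (\<lambda>x. x \<notin> N) es"
          by (auto simp: N_def intro!: filter_True filter_cong)
        then show "?change e (e # es) \<le> 1 + hamming (?g es) (?g (filter (\<lambda>x. x \<notin> N) es))"
          by (simp add: greedy_matching_Cons hamming_insert_le)
      qed simp
      also have "\<dots> = 1 + random_order_expectation (H - {e})
          (\<lambda>es. hamming (?g es) (?g (filter (\<lambda>x. x \<notin> N) es)))"
        by (subst Bochner_Integration.integral_add) (auto intro!: integrable_random_order)
      also have "\<dots> \<le> 1 + real (card N)"
        using \<open>e \<in> H\<close>
        by (intro add_left_mono expected_change_delete_set smaller) (auto simp: N_def)
      finally show ?thesis using same by simp
    next
      case adj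
      \<comment> \<open>Discarding the edges that meet \<open>f\<close> already discards
        \<open>e\<close>.\<close>
      then have "filter (\<lambda>x. x \<inter> f = {}) (filter (\<lambda>x. x \<noteq> e) es) = filter (\<lambda>x. x \<inter> f = {}) es"
        for es
        by (auto simp: N_def intro!: filter_cong)
      then have "?change e (f # es) = 0" for es
        using adj by (auto simp: greedy_matching_Cons N_def)
      then show ?thesis using adj \<open>e \<notin> N\<close> by auto
    next
      case far
      have "random_order_expectation (H - {f}) (\<lambda>es. ?change e (f # es)) \<le>
          random_order_expectation (H - {f}) (\<lambda>es. ?change e (filter (\<lambda>x. x \<inter> f = {}) es))"
      proof (rule random_order_expectation_mono)
        fix es
        have "filter (\<lambda>x. x \<inter> f = {}) (filter (\<lambda>x. x \<noteq> e) es) =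
                filter (\<lambda>x. x \<noteq> e) (filter (\<lambda>x. x \<inter> f = {}) es)"
          by (simp add: conj_commute)
        then show "?change e (f # es) \<le> ?change e (filter (\<lambda>x. x \<inter> f = {}) es)"
          using far by (simp only: filter.simps greedy_matching_Cons if_True simp_thms)
            (intro hamming_insert_insert_le finite_greedy_matching)
      qed simp
      also have "\<dots> = random_order_expectation {x \<in> H - {f}. x \<inter> f = {}} (?change e)"
        by (rule random_order_expectation_filter) simp
      \<comment> \<open>Since \<open>e\<close> misses \<open>f\<close>, it survives the restriction,
        as the induction hypothesis requires.\<close>
      also have "\<dots> \<le> 1"
        using far that \<open>e \<in> H\<close> by (intro smaller[of _ f]) auto
      finally show ?thesis using far by (auto simp: N_def)
    qed
  qed
  then have "(\<Sum>f\<in>H. random_order_expectation (H - {f}) (\<lambda>es. ?change e (f # es))) \<le>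
      (\<Sum>f\<in>H. if f = e then 1 + real (card N) else if f \<in> N then 0 else 1)"
    by (rule sum_mono)
  \<comment> \<open>The extra cost \<open>card N\<close> at \<open>f = e\<close> is exactly offset
    by the \<open>card N\<close> first edges that cost nothing.\<close>
  also have "\<dots> = (\<Sum>f\<in>H. 1 + (if f = e then real (card N) else 0) - (if f \<in> N then 1 else 0))"
    using \<open>e \<notin> N\<close> by (intro sum.cong) auto
  also have "\<dots> = real (card H)"
    using \<open>e \<in> H\<close> \<open>N \<subseteq> H\<close>
    by (simp add: sum.distrib sum_subtractf sum.delta' Int_absorb1 flip: sum.inter_restrict)
  finally show ?case
    using \<open>e \<in> H\<close> by (subst random_order_expectation_first) (auto simp: divide_le_eq)
qed

lemma em_dist_le_expectation:
  assumes "r \<in> couplings p q"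
  shows "em_dist p q \<le> measure_pmf.expectation r (\<lambda>(A, B). hamming A B)"
  unfolding em_dist_def using assms
  \<comment> \<open>A real infimum bounds its members only if the set is bounded below;
    \<open>0\<close> serves, as Hamming distances are nonnegative.\<close>
  by (intro cINF_lower bdd_belowI[of _ 0]) (auto intro!: integral_nonneg_AE)

text \<open>The coupling feeds one random order to both runs. Its second marginal is correct because
  removing \<open>e\<close> from a uniform order of \<open>E\<close> leaves a uniform order of
  \<open>E - {e}\<close>.\<close>

lemma em_dist_randomized_greedy_matching_delete:
  assumes "finite E" "e \<in> E"
  shows "em_dist (randomized_greedy_matching V E) (randomized_greedy_matching V (E - {e})) \<le> 1"
proof -
  let ?del = "filter (\<lambda>x. x \<noteq> e)"
  define r where "r = map_pmf (\<lambda>es. (greedy_matching es, greedy_matching (?del es)))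
    (pmf_of_set (permutations_of_set E))"
  have "{x \<in> E. x \<noteq> e} = E - {e}" by auto
  then have "map_pmf (\<lambda>es. greedy_matching (?del es)) (pmf_of_set (permutations_of_set E)) =
      randomized_greedy_matching V (E - {e})"
    using random_order_filter[OF \<open>finite E\<close>, of "\<lambda>x. x \<noteq> e"]
    by (simp add: randomized_greedy_matching_def flip: map_pmf_comp[of greedy_matching ?del])
  then have "r \<in> couplings (randomized_greedy_matching V E) (randomized_greedy_matching V (E - {e}))"
    by (simp add: couplings_def r_def pmf.map_comp o_def randomized_greedy_matching_def)
  from em_dist_le_expectation[OF this] expected_change_delete[OF assms] show ?thesis
    by (simp add: r_def)
qed

lemma max_degree_ge_1:
  assumes "finite_simple_graph V E" "E \<noteq> {}"
  shows "1 \<le> max_degree V E"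
proof -
  from assms have "finite V" and sub: "\<And>e. e \<in> E \<Longrightarrow> e \<subseteq> V"
    by (auto simp: finite_simple_graph_def)
  from assms obtain e where e: "e \<in> E" "card e = 2" by (auto simp: finite_simple_graph_def)
  then obtain v where "v \<in> e" by fastforce
  have "finite E" using \<open>finite V\<close> sub by (meson finite_Pow_iff finite_subset PowI subsetI)
  then have "1 \<le> vertex_degree E v"
    using e \<open>v \<in> e\<close> by (auto simp: vertex_degree_def Suc_le_eq card_gt_0_iff)
  also have "\<dots> \<le> max_degree V E"
    unfolding max_degree_def using \<open>finite V\<close> sub[OF e(1)] \<open>v \<in> e\<close> by (intro Max_ge) auto
  finally show ?thesis .
qed

theorem mainTheorem9:
  fixes V :: "'a set" and E :: "'a set set"
  assumes "finite_simple_graph V E"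
  shows "average_sensitivity randomized_greedy_matching V E \<le> 1 / 2 + real (max_degree V E)"
proof (cases "E = {}")
  case True
  \<comment> \<open>The average is \<open>0 / 0 = 0\<close> here. This case is separate because
    \<open>max_degree\<close> can be \<open>0\<close>, so the bound \<open>1\<close> would not
    suffice.\<close>
  then show ?thesis by (simp add: average_sensitivity_def)
next
  case False
  have "E \<subseteq> Pow V" "finite V" using assms by (auto simp: finite_simple_graph_def)
  then have "finite E" by (meson finite_Pow_iff finite_subset)
  then have "(\<Sum>e\<in>E. em_dist (randomized_greedy_matching V E)
      (randomized_greedy_matching V (E - {e}))) \<le> real (card E)"
    using sum_bounded_above[of E _ "1 :: real"] em_dist_randomized_greedy_matching_delete[of E]
    by (metis mult.right_neutral)
  then have "average_sensitivity randomized_greedy_matching V E \<le> 1"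
    using \<open>finite E\<close> False by (simp add: average_sensitivity_def divide_le_eq card_gt_0_iff)
  also have "\<dots> \<le> 1 / 2 + real (max_degree V E)"
    using max_degree_ge_1[OF assms False] by linarith
  finally show ?thesis .
qed

end
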